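(* Let $G$ be a finitely generated group, let $A$ and $B$ be two proper subgroups of $G$, let $\phi : A \to B$ be an isomorphism, and let $\Gamma = (G,A,B,t)$ be the (proper) HNN extension of $G$ relative to $A$, $B$ and $\phi$. Then $\mathrm{girth}(\Gamma) = \infty$.
   Context: HNN extension: for a group $G$, subgroups $A, B \leq G$ and an isomorphism $\phi : A \to B$, the HNN extension of $G$ relative to $A$, $B$ and $\phi$ with stable letter $t$ is $(G,A,B,t) = \langle G, t \mid t^{-1} a t = \phi(a) \text{ for } a \in A\rangle$. It is called proper when both $A \neq G$ and $B \neq G$. Girth: for a finitely generated group $\Gamma$ and a finite generating set $S$ of $\Gamma$, $\mathrm{girth}(\Gamma, S)$ is the length of the shortest non-trivial relation of $\Gamma$ with respect to $S$, i.e. the minimal length of a non-empty freely reduced word in the alphabet $S^{\pm 1}$ which represents the identity of $\Gamma$ (and $\infty$ if there is no such word). Then $\mathrm{girth}(\Gamma) = \sup\{\mathrm{girth}(\Gamma, S) : S \subset \Gamma,\ \langle S\rangle = \Gamma,\ |S| < \infty\}$. *)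

theory Defs
  imports "HOL-Algebra.Generated_Groups" "HOL-Library.Extended_Nat"
begin

text \<open>A group word is a list of letters: \<open>(x, True)\<close> stands for \<open>x\<close> and \<open>(x, False)\<close>
  for its formal inverse.\<close>

type_synonym 'x gword = "('x \<times> bool) list"

definition gwords :: "'x set \<Rightarrow> 'x gword set" where
  "gwords X = lists (X \<times> UNIV)"

definition freely_reduced :: "'x gword \<Rightarrow> bool" where
  "freely_reduced = successively (\<lambda>p q. \<not> (fst p = fst q \<and> snd p \<noteq> snd q))"

definition word_value :: "('a, 'b) monoid_scheme \<Rightarrow> 'a gword \<Rightarrow> 'a" where
  "word_value G w = foldr (\<lambda>(x, e) y. (if e then x else inv\<^bsub>G\<^esub> x) \<otimes>\<^bsub>G\<^esub> y) w \<one>\<^bsub>G\<^esub>"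


section \<open>Finite generating sets and girth\<close>

definition finite_generating_set :: "('a, 'b) monoid_scheme \<Rightarrow> 'a set \<Rightarrow> bool" where
  "finite_generating_set G S \<longleftrightarrow> finite S \<and> S \<subseteq> carrier G \<and> generate G S = carrier G"

definition finitely_generated :: "('a, 'b) monoid_scheme \<Rightarrow> bool" where
  "finitely_generated G \<longleftrightarrow> (\<exists>S. finite_generating_set G S)"

text \<open>The words are formal: an involution \<open>s \<in> S\<close>, or a pair of distinct mutually inverse
  elements of \<open>S\<close>, gives a relation of length 2.  In \<^typ>\<open>enat\<close> the infimum of the empty set
  is \<open>\<infinity>\<close>, as required when there is no relation.\<close>

definition girth_wrt :: "('a, 'b) monoid_scheme \<Rightarrow> 'a set \<Rightarrow> enat" where
  "girth_wrt G S =
     (INF w \<in> {w \<in> gwords S. w \<noteq> [] \<and> freely_reduced w \<and> word_value G w = \<one>\<^bsub>G\<^esub>}.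
        enat (length w))"

definition girth :: "('a, 'b) monoid_scheme \<Rightarrow> enat" where
  "girth G = (SUP S \<in> {S. finite_generating_set G S}. girth_wrt G S)"


section \<open>Groups given by generators and relations\<close>

text \<open>\<open>pres_eq X R u v\<close>: the words \<open>u\<close> and \<open>v\<close> over \<open>X\<close> are equal in the group
  \<open>\<langle>X | u = v for (u, v) \<in> R\<rangle>\<close>.\<close>

inductive pres_eq :: "'x set \<Rightarrow> ('x gword \<times> 'x gword) set \<Rightarrow> 'x gword \<Rightarrow> 'x gword \<Rightarrow> bool"
  for X :: "'x set" and R :: "('x gword \<times> 'x gword) set" where
  refl: "w \<in> gwords X \<Longrightarrow> pres_eq X R w w"
| sym: "pres_eq X R u v \<Longrightarrow> pres_eq X R v u"
| trans: "pres_eq X R u v \<Longrightarrow> pres_eq X R v w \<Longrightarrow> pres_eq X R u w"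
| append: "pres_eq X R u u' \<Longrightarrow> pres_eq X R v v' \<Longrightarrow> pres_eq X R (u @ v) (u' @ v')"
| cancel: "x \<in> X \<Longrightarrow> pres_eq X R [(x, e), (x, \<not> e)] []"
| rel: "(u, v) \<in> R \<Longrightarrow> u \<in> gwords X \<Longrightarrow> v \<in> gwords X \<Longrightarrow> pres_eq X R u v"

definition pres_class :: "'x set \<Rightarrow> ('x gword \<times> 'x gword) set \<Rightarrow> 'x gword \<Rightarrow> 'x gword set" where
  "pres_class X R w = {v. pres_eq X R w v}"

definition presented_group ::
    "'x set \<Rightarrow> ('x gword \<times> 'x gword) set \<Rightarrow> 'x gword set monoid" where
  "presented_group X R =
     \<lparr>carrier = pres_class X R ` gwords X,
      monoid.mult = (\<lambda>C D. \<Union>u\<in>C. \<Union>v\<in>D. pres_class X R (u @ v)),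
      one = pres_class X R []\<rparr>"


section \<open>HNN extensions\<close>

datatype 'a hnn_gen = Base 'a | Stable

text \<open>\<open>G\<close> enters the presentation through all of its elements, subject to its multiplication
  table.  The second associated subgroup is \<open>\<phi> ` A\<close> and need not be mentioned.\<close>

definition hnn_gens :: "('a, 'b) monoid_scheme \<Rightarrow> 'a hnn_gen set" where
  "hnn_gens G = insert Stable (Base ` carrier G)"

definition hnn_rels :: "('a, 'b) monoid_scheme \<Rightarrow> 'a set \<Rightarrow> ('a \<Rightarrow> 'a)
    \<Rightarrow> ('a hnn_gen gword \<times> 'a hnn_gen gword) set" where
  "hnn_rels G A \<phi> =
     {([(Base g, True), (Base h, True)], [(Base (g \<otimes>\<^bsub>G\<^esub> h), True)])
        | g h. g \<in> carrier G \<and> h \<in> carrier G} \<union>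
     {([(Stable, False), (Base a, True), (Stable, True)], [(Base (\<phi> a), True)]) | a. a \<in> A}"

definition hnn_extension ::
    "('a, 'b) monoid_scheme \<Rightarrow> 'a set \<Rightarrow> ('a \<Rightarrow> 'a) \<Rightarrow> 'a hnn_gen gword set monoid" where
  "hnn_extension G A \<phi> = presented_group (hnn_gens G) (hnn_rels G A \<phi>)"


section \<open>Presented groups are groups\<close>

lemma pres_eq_gwords: "pres_eq X R u v \<Longrightarrow> u \<in> gwords X \<and> v \<in> gwords X"
  by (induction rule: pres_eq.induct) (auto simp: gwords_def)

lemma pres_class_eq_iff:
  "u \<in> gwords X \<Longrightarrow> pres_class X R u = pres_class X R v \<longleftrightarrow> pres_eq X R u v"
  unfolding pres_class_def set_eq_iff mem_Collect_eq
  by (metis pres_eq.refl pres_eq.sym pres_eq.trans)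

lemma mult_presented_group:
  assumes "u \<in> gwords X" "v \<in> gwords X"
  shows "pres_class X R u \<otimes>\<^bsub>presented_group X R\<^esub> pres_class X R v = pres_class X R (u @ v)"
proof -
  have "pres_class X R (u' @ v') = pres_class X R (u @ v)"
    if "u' \<in> pres_class X R u" "v' \<in> pres_class X R v" for u' v'
    using that pres_eq.append[of X R u u' v v'] pres_class_eq_iff[of "u @ v" X R "u' @ v'"]
    by (auto simp: pres_class_def dest: pres_eq_gwords)
  moreover have "u \<in> pres_class X R u" "v \<in> pres_class X R v"
    using assms by (auto simp: pres_class_def intro: pres_eq.refl)
  ultimately have "(\<Union>u'\<in>pres_class X R u. \<Union>v'\<in>pres_class X R v. pres_class X R (u' @ v'))
      = pres_class X R (u @ v)"
    by blast
  then show ?thesis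
    by (simp add: presented_group_def)
qed

definition gword_inv :: "'x gword \<Rightarrow> 'x gword" where
  "gword_inv w = rev (map (\<lambda>(x, e). (x, \<not> e)) w)"

lemma gword_inv_in: "w \<in> gwords X \<Longrightarrow> gword_inv w \<in> gwords X"
  by (auto simp: gwords_def gword_inv_def)

lemma pres_eq_inv_left: "w \<in> gwords X \<Longrightarrow> pres_eq X R (gword_inv w @ w) []"
proof (induction w)
  case Nil
  then show ?case by (auto simp: gword_inv_def gwords_def intro: pres_eq.refl)
next
  case (Cons p w)
  obtain x e where p: "p = (x, e)" by fastforce
  have x: "x \<in> X" and w: "w \<in> gwords X"
    using Cons.prems p by (auto simp: gwords_def)
  have "pres_eq X R ([(x, \<not> e), (x, e)] @ w) ([] @ w)"
    using pres_eq.append[OF pres_eq.cancel[OF x, of R "\<not> e"] pres_eq.refl[OF w]] by simp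
  from pres_eq.append[OF pres_eq.refl[OF gword_inv_in[OF w]] this]
  have "pres_eq X R (gword_inv (p # w) @ p # w) (gword_inv w @ w)"
    by (simp add: gword_inv_def p)
  then show ?case
    using Cons.IH[OF w] by (rule pres_eq.trans)
qed

lemma group_presented_group: "group (presented_group X R)"
proof (rule groupI)
  let ?P = "presented_group X R"
  have car: "carrier ?P = pres_class X R ` gwords X" and one: "\<one>\<^bsub>?P\<^esub> = pres_class X R []"
    by (simp_all add: presented_group_def)
  have app: "u @ v \<in> gwords X" if "u \<in> gwords X" "v \<in> gwords X" for u v
    using that by (simp add: gwords_def)
  have nil: "[] \<in> gwords X" by (simp add: gwords_def)
  show "x \<otimes>\<^bsub>?P\<^esub> y \<in> carrier ?P" if "x \<in> carrier ?P" "y \<in> carrier ?P" for x y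
    using that by (auto simp: car mult_presented_group app)
  show "\<one>\<^bsub>?P\<^esub> \<in> carrier ?P"
    by (simp add: car one nil)
  show "x \<otimes>\<^bsub>?P\<^esub> y \<otimes>\<^bsub>?P\<^esub> z = x \<otimes>\<^bsub>?P\<^esub> (y \<otimes>\<^bsub>?P\<^esub> z)"
    if "x \<in> carrier ?P" "y \<in> carrier ?P" "z \<in> carrier ?P" for x y z
    using that by (auto simp: car mult_presented_group app)
  show "\<one>\<^bsub>?P\<^esub> \<otimes>\<^bsub>?P\<^esub> x = x" if "x \<in> carrier ?P" for x
    using that by (auto simp: car one mult_presented_group nil)
  show "\<exists>y\<in>carrier ?P. y \<otimes>\<^bsub>?P\<^esub> x = \<one>\<^bsub>?P\<^esub>" if "x \<in> carrier ?P" for x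
  proof -
    obtain w where w: "w \<in> gwords X" "x = pres_class X R w"
      using \<open>x \<in> carrier ?P\<close> car by auto
    have "pres_class X R (gword_inv w) \<otimes>\<^bsub>?P\<^esub> x = \<one>\<^bsub>?P\<^esub>"
      using w pres_eq_inv_left[OF w(1), of R]
      by (simp add: mult_presented_group gword_inv_in one pres_class_eq_iff app)
    then show ?thesis
      using gword_inv_in[OF w(1)] car by blast
  qed
qed

end

theory Submission
  imports Defs
begin

text \<open>Given \<open>N\<close>, choose \<open>s \<in> G - (A \<union> B)\<close> and generators \<open>g\<^sub>1, \<dots>, g\<^sub>n\<close> of \<open>G\<close>, and let \<open>S\<close> consist of
  \<open>t\<close> and of the elements \<open>t\<^sup>a c t\<^sup>a\<close>, where the core \<open>c\<close> is \<open>s\<close> or some \<open>s t g\<^sub>i t s\<close> and the exponents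
  \<open>a > N\<close> belonging to different cores differ by more than \<open>N\<close>.  Clearly \<open>S\<close> generates \<open>\<Gamma>\<close>.  In a freely
  reduced word of length at most \<open>N\<close> over \<open>S\<close>, adjacent cores are separated by a non-zero power of
  \<open>t\<close>; since the cores begin and end with \<open>s\<^sup>\<plusminus>\<^sup>1\<close>, which lies in neither \<open>A\<close> nor \<open>B\<close>, the resulting
  expression contains no pinch \<open>t\<^sup>-\<^sup>1 a t\<close> or \<open>t b t\<^sup>-\<^sup>1\<close>, and is non-trivial by Britton's lemma.  The part of
  that lemma used here comes from the action of \<open>\<Gamma>\<close> on normal forms.\<close>

section \<open>The action of an HNN extension on normal forms\<close>

text \<open>Otherwise \<open>x\<close> outside \<open>A\<close> lies in \<open>B\<close> and
  \<open>y\<close> outside \<open>B\<close> lies in \<open>A\<close>, so that their product can lie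
  in neither. Properness of the extension enters here.\<close>

lemma (in group) exists_outside_two_subgroups:
  assumes A: "subgroup A G" "A \<noteq> carrier G" and B: "subgroup B G" "B \<noteq> carrier G"
  shows "\<exists>s\<in>carrier G. s \<notin> A \<and> s \<notin> B"
proof (rule ccontr)
  assume neg: "\<not> ?thesis"
  obtain x where x: "x \<in> carrier G" "x \<notin> A"
    using A subgroup.subset[OF A(1)] by blast
  obtain y where y: "y \<in> carrier G" "y \<notin> B"
    using B subgroup.subset[OF B(1)] by blast
  have "x \<in> B" "y \<in> A" "x \<otimes> y \<in> A \<or> x \<otimes> y \<in> B"
    using neg x y by auto
  then show False
    using x y A(1) B(1)
    by (metis inv_solve_left inv_solve_right subgroup.m_closed subgroup.m_inv_closed m_closed)
qed

locale hnn_datum = group G for G (structure) +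
  fixes A B :: "'a set" and \<phi> :: "'a \<Rightarrow> 'a"
  assumes subgroup_A: "subgroup A G" and subgroup_B: "subgroup B G"
    and iso_\<phi>: "\<phi> \<in> iso (G\<lparr>carrier := A\<rparr>) (G\<lparr>carrier := B\<rparr>)"
begin

text \<open>The exponent of \<open>t\<^sup>\<plusminus>\<^sup>1\<close> is encoded by a Boolean, so that \<open>t\<^sup>e d = transport e d t\<^sup>e\<close> for
  \<open>d \<in> assoc_subgroup e\<close>.\<close>

definition assoc_subgroup :: "bool \<Rightarrow> 'a set" where
  "assoc_subgroup e = (if e then B else A)"

definition transport :: "bool \<Rightarrow> 'a \<Rightarrow> 'a" where
  "transport e = (if e then inv_into A \<phi> else \<phi>)"

lemma bij_\<phi>: "bij_betw \<phi> A B"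
  using iso_\<phi> by (auto simp: iso_def)

lemma subgroup_assoc: "subgroup (assoc_subgroup e) G"
  by (simp add: assoc_subgroup_def subgroup_A subgroup_B)

lemmas assoc_carrier = subgroup.mem_carrier[OF subgroup_assoc]
  and assoc_mult = subgroup.m_closed[OF subgroup_assoc]
  and assoc_inv = subgroup.m_inv_closed[OF subgroup_assoc]

lemma transport_in: "d \<in> assoc_subgroup e \<Longrightarrow> transport e d \<in> assoc_subgroup (\<not> e)"
  using bij_\<phi> by (auto simp: assoc_subgroup_def transport_def bij_betw_def inv_into_into)

lemma transport_carrier: "d \<in> assoc_subgroup e \<Longrightarrow> transport e d \<in> carrier G"
  by (blast intro: transport_in assoc_carrier)

lemma transport_transport: "d \<in> assoc_subgroup e \<Longrightarrow> transport (\<not> e) (transport e d) = d"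
  using bij_\<phi> by (auto simp: assoc_subgroup_def transport_def bij_betw_def f_inv_into_f)

lemma transport_mult:
  assumes "c \<in> assoc_subgroup e" "d \<in> assoc_subgroup e"
  shows "transport e (c \<otimes> d) = transport e c \<otimes> transport e d"
proof (cases e)
  case False
  then show ?thesis
    using assms iso_\<phi> by (auto simp: assoc_subgroup_def transport_def iso_def hom_def)
next
  case True
  \<comment> \<open>Since \<open>\<phi>\<close> is injective on \<open>A\<close>, it suffices to
    compare images under \<open>\<phi>\<close>.\<close>
  have "\<phi> (transport True c \<otimes> transport True d) = c \<otimes> d"
    using assms True iso_\<phi> transport_in[of c True] transport_in[of d True]
      transport_transport[of c True] transport_transport[of d True]
    by (auto simp: assoc_subgroup_def transport_def iso_def hom_def)
  moreover have "transport True c \<otimes> transport True d \<in> A"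
    using assms True transport_in[of c True] transport_in[of d True] assoc_mult[of _ False]
    by (auto simp: assoc_subgroup_def)
  ultimately show ?thesis
    using True bij_\<phi> by (metis bij_betw_def inv_into_f_f transport_def)
qed

text \<open>The choice depends only on the coset, and the representative of the subgroup itself may
  differ from \<open>\<one>\<close>. Hence \<open>normal\<close> tests for pinches by membership,
  not by comparison with \<open>\<one>\<close>.\<close>

definition rep :: "bool \<Rightarrow> 'a \<Rightarrow> 'a" where
  "rep e g = (SOME h. h \<in> assoc_subgroup e #> g)"

lemma rep_cases:
  assumes "g \<in> carrier G"
  obtains d where "d \<in> assoc_subgroup e" "g = d \<otimes> rep e g" "rep e g \<in> carrier G"
proof -
  have "rep e g \<in> assoc_subgroup e #> g"
    unfolding rep_def using rcos_self[OF assms subgroup_assoc] by (rule someI)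
  then obtain d where d: "d \<in> assoc_subgroup e" "rep e g = d \<otimes> g"
    by (auto simp: r_coset_def)
  with assms assoc_carrier[OF d(1)] have "g = inv d \<otimes> rep e g" "rep e g \<in> carrier G"
    by (auto simp: m_assoc[symmetric])
  with that d(1) show thesis
    by (blast intro: assoc_inv)
qed

lemma rep_mult:
  assumes "d \<in> assoc_subgroup e" "g \<in> carrier G"
  shows "rep e (d \<otimes> g) = rep e g"
proof -
  have "assoc_subgroup e #> (d \<otimes> g) = assoc_subgroup e #> g"
    using assms assoc_carrier[of _ e] coset_mult_assoc[of "assoc_subgroup e" d g]
      coset_join2[of d "assoc_subgroup e"] subgroup_assoc subgroup.subset[OF subgroup_assoc]
    by auto
  then show ?thesis
    by (simp add: rep_def)
qed

text \<open>A pair \<open>(g, [(e\<^sub>1, r\<^sub>1), \<dots>, (e\<^sub>n, r\<^sub>n)])\<close> stands for the expression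
  \<open>g t\<^bsup>e\<^sub>1\<^esup> r\<^sub>1 \<dots> t\<^bsup>e\<^sub>n\<^esup> r\<^sub>n\<close>.  Multiplication by \<open>t\<^sup>e\<close> from the left produces a pinch at its
  beginning iff \<open>pinches e\<close> holds.\<close>

type_synonym 'c nform = "'c \<times> (bool \<times> 'c) list"

definition pinches :: "bool \<Rightarrow> 'a nform \<Rightarrow> bool" where
  "pinches e p \<longleftrightarrow> fst p \<in> assoc_subgroup e \<and> snd p \<noteq> [] \<and> fst (hd (snd p)) = (\<not> e)"

definition step :: "bool \<Rightarrow> 'a nform \<Rightarrow> 'a nform" where
  "step e p =
     (if pinches e p then (transport e (fst p) \<otimes> snd (hd (snd p)), tl (snd p))
      else (transport e (fst p \<otimes> inv (rep e (fst p))), (e, rep e (fst p)) # snd p))"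

definition left_mult :: "'a \<Rightarrow> 'a nform \<Rightarrow> 'a nform" where
  "left_mult g p = (g \<otimes> fst p, snd p)"

fun normal :: "(bool \<times> 'a) list \<Rightarrow> bool" where
  "normal [] \<longleftrightarrow> True"
| "normal ((e, r) # w) \<longleftrightarrow> r \<in> carrier G \<and> rep e r = r \<and> \<not> pinches e (r, w) \<and> normal w"

definition nforms :: "'a nform set" where
  "nforms = {p. fst p \<in> carrier G \<and> normal (snd p)}"

section \<open>The action of a single stable letter\<close>

lemma step_pinch:
  "d \<in> assoc_subgroup e \<Longrightarrow> step e (d, (\<not> e, r) # w) = (transport e d \<otimes> r, w)"
  by (simp add: step_def pinches_def)

lemma step_no_pinch:
  assumes "\<not> pinches e (d \<otimes> r, w)" "d \<in> assoc_subgroup e" "r \<in> carrier G" "rep e r = r"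
  shows "step e (d \<otimes> r, w) = (transport e d, (e, r) # w)"
  using assms assoc_carrier[OF assms(2)] by (simp add: step_def rep_mult m_assoc)

lemma assoc_mult_iff:
  assumes "d \<in> assoc_subgroup e" "g \<in> carrier G"
  shows "d \<otimes> g \<in> assoc_subgroup e \<longleftrightarrow> g \<in> assoc_subgroup e"
proof
  assume "d \<otimes> g \<in> assoc_subgroup e"
  then have "inv d \<otimes> (d \<otimes> g) \<in> assoc_subgroup e"
    using assms by (blast intro: assoc_inv assoc_mult)
  then show "g \<in> assoc_subgroup e"
    using assms assoc_carrier[OF assms(1)] by (simp add: m_assoc[symmetric])
qed (use assms assoc_mult in blast)

text \<open>Without a pinch the first entry splits as \<open>d \<otimes> rep e g\<close>, and
  replacing \<open>g\<close> by its representative creates no pinch. The two shapes are those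
  evaluated by \<open>step_pinch\<close> and \<open>step_no_pinch\<close>.\<close>

lemma nform_cases:
  assumes "p \<in> nforms"
  obtains
    (pinch) d r w where "p = (d, (\<not> e, r) # w)" "d \<in> assoc_subgroup e" "r \<in> carrier G"
      "rep (\<not> e) r = r" "\<not> pinches (\<not> e) (r, w)" "normal w"
  | (no_pinch) d r w where "p = (d \<otimes> r, w)" "d \<in> assoc_subgroup e" "r \<in> carrier G"
      "rep e r = r" "\<not> pinches e (r, w)" "normal w"
proof (cases "pinches e p")
  case True
  with assms show thesis
    by (cases p; cases "snd p") (auto simp: pinches_def nforms_def intro!: pinch)
next
  case False
  obtain g w where p: "p = (g, w)" "g \<in> carrier G" "normal w"
    using assms by (cases p) (auto simp: nforms_def)
  obtain d where d: "d \<in> assoc_subgroup e" "g = d \<otimes> rep e g" "rep e g \<in> carrier G"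
    using rep_cases[OF p(2)] by blast
  then have "rep e (rep e g) = rep e g"
    using rep_mult by metis
  moreover have "\<not> pinches e (rep e g, w)"
    using False d p(1) assoc_mult_iff[OF d(1,3)] by (simp add: pinches_def)
  ultimately show thesis
    using no_pinch[of d "rep e g" w] d p by simp
qed

lemma pinches_left_mult:
  assumes "d \<in> assoc_subgroup e" "g \<in> carrier G"
  shows "pinches e (d \<otimes> g, w) \<longleftrightarrow> pinches e (g, w)"
  using assoc_mult_iff[OF assms] by (simp add: pinches_def)

lemma step_in_nforms:
  assumes "p \<in> nforms"
  shows "step e p \<in> nforms"
  using assms
proof (cases rule: nform_cases[where e = e])
  case pinch
  then show ?thesis
    by (auto simp: step_pinch nforms_def transport_carrier)
next
  case no_pinch
  then show ?thesis
    by (auto simp: step_no_pinch pinches_left_mult nforms_def transport_carrier)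
qed

text \<open>\<open>step e\<close> exchanges the two shapes: a pinch for \<open>e\<close> becomes a
  no-pinch for \<open>\<not> e\<close>, and a no-pinch for \<open>e\<close> a pinch for
  \<open>\<not> e\<close>. The two transports of \<open>d\<close> undo each other.\<close>

lemma step_step:
  assumes "p \<in> nforms"
  shows "step (\<not> e) (step e p) = p"
  using assms
proof (cases rule: nform_cases[where e = e])
  case (pinch d r w)
  then show ?thesis
    using step_no_pinch[of "\<not> e" "transport e d" r w]
    by (simp add: step_pinch transport_in pinches_left_mult transport_transport)
next
  case (no_pinch d r w)
  then show ?thesis
    using step_pinch[of "transport e d" "\<not> e" r w]
    by (simp add: step_no_pinch transport_in pinches_left_mult transport_transport)
qed

lemma left_mult_in_nforms: "g \<in> carrier G \<Longrightarrow> p \<in> nforms \<Longrightarrow> left_mult g p \<in> nforms"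
  by (auto simp: left_mult_def nforms_def)

lemma step_left_mult:
  assumes "p \<in> nforms" "c \<in> assoc_subgroup e"
  shows "step e (left_mult c p) = left_mult (transport e c) (step e p)"
  using assms(1)
proof (cases rule: nform_cases[where e = e])
  case (pinch d r w)
  then show ?thesis
    using assms(2)
    by (simp add: step_pinch left_mult_def assoc_mult transport_mult m_assoc transport_carrier)
next
  case (no_pinch d r w)
  then show ?thesis
    using assms(2) step_no_pinch[of e "c \<otimes> d" r w]
    by (simp add: step_no_pinch left_mult_def assoc_mult transport_mult pinches_left_mult
        m_assoc[symmetric] assoc_carrier)
qed

section \<open>The action of words and its invariance under the relations\<close>

fun letter_action :: "'a hnn_gen \<times> bool \<Rightarrow> 'a nform \<Rightarrow> 'a nform" where
  "letter_action (Stable, e) = step e"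
| "letter_action (Base g, e) = left_mult (if e then g else inv g)"

definition word_action :: "'a hnn_gen gword \<Rightarrow> 'a nform \<Rightarrow> 'a nform" where
  "word_action = foldr letter_action"

lemma word_action_append: "word_action (u @ v) p = word_action u (word_action v p)"
  by (simp add: word_action_def)

lemma word_action_in_nforms:
  assumes "u \<in> gwords (hnn_gens G)" "p \<in> nforms"
  shows "word_action u p \<in> nforms"
  using assms
  by (induction u)
    (auto simp: word_action_def gwords_def hnn_gens_def step_in_nforms left_mult_in_nforms)

lemma left_mult_left_mult:
  "g \<in> carrier G \<Longrightarrow> h \<in> carrier G \<Longrightarrow> p \<in> nforms \<Longrightarrow>
    left_mult g (left_mult h p) = left_mult (g \<otimes> h) p"
  by (simp add: left_mult_def nforms_def m_assoc)

lemma left_mult_one: "p \<in> nforms \<Longrightarrow> left_mult \<one> p = p"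
  by (simp add: left_mult_def nforms_def)

text \<open>Cancellation is \<open>step_step\<close>, the multiplication table is associativity, and
  the relation of the stable letter is \<open>step_left_mult\<close> at sign \<open>False\<close>
  followed by \<open>step_step\<close>.\<close>

lemma word_action_pres_eq:
  assumes "pres_eq (hnn_gens G) (hnn_rels G A \<phi>) u v" "p \<in> nforms"
  shows "word_action u p = word_action v p"
  using assms
proof (induction arbitrary: p rule: pres_eq.induct)
  case (append u u' v v')
  then have "word_action v' p \<in> nforms"
    by (meson word_action_in_nforms pres_eq_gwords)
  with append show ?case
    by (simp add: word_action_append)
next
  case (cancel x e)
  then show ?case
    using step_step[of p "\<not> e"]
    by (auto simp: word_action_def hnn_gens_def left_mult_left_mult left_mult_one)
next
  case (rel u v)
  from rel.hyps(1) consider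
      g h where "u = [(Base g, True), (Base h, True)]" "v = [(Base (g \<otimes> h), True)]"
        "g \<in> carrier G" "h \<in> carrier G"
    | a where "u = [(Stable, False), (Base a, True), (Stable, True)]" "v = [(Base (\<phi> a), True)]"
        "a \<in> A"
    by (auto simp: hnn_rels_def)
  then show ?case
  proof cases
    case 1
    then show ?thesis
      using rel.prems by (simp add: word_action_def left_mult_left_mult)
  next
    case 2
    then show ?thesis
      using rel.prems step_left_mult[of "step True p" a False] step_step[of p True]
      by (simp add: word_action_def step_in_nforms assoc_subgroup_def transport_def)
  qed
qed auto

section \<open>The extension as a group and the orbit of the trivial normal form\<close>

abbreviation \<Gamma> where "\<Gamma> \<equiv> hnn_extension G A \<phi>"

definition cls :: "'a hnn_gen gword \<Rightarrow> 'a hnn_gen gword set" where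
  "cls = pres_class (hnn_gens G) (hnn_rels G A \<phi>)"

definition base :: "'a \<Rightarrow> 'a hnn_gen gword set" where
  "base g = cls [(Base g, True)]"

definition stable :: "bool \<Rightarrow> 'a hnn_gen gword set" where
  "stable e = cls [(Stable, e)]"

text \<open>The chosen word does not matter, by \<open>word_action_pres_eq\<close>. This map
  replaces Britton's lemma: an element not sent to \<open>(\<one>, [])\<close> is
  non-trivial.\<close>

definition orbit_map :: "'a hnn_gen gword set \<Rightarrow> 'a nform" where
  "orbit_map z = word_action (SOME w. w \<in> z) (\<one>, [])"

sublocale ext: group \<Gamma>
  by (simp add: hnn_extension_def group_presented_group)

lemma carrier_\<Gamma>: "carrier \<Gamma> = cls ` gwords (hnn_gens G)"
  by (simp add: hnn_extension_def presented_group_def cls_def)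

lemma one_\<Gamma>: "\<one>\<^bsub>\<Gamma>\<^esub> = cls []"
  by (simp add: hnn_extension_def presented_group_def cls_def)

lemma mult_cls:
  "u \<in> gwords (hnn_gens G) \<Longrightarrow> v \<in> gwords (hnn_gens G) \<Longrightarrow> cls u \<otimes>\<^bsub>\<Gamma>\<^esub> cls v = cls (u @ v)"
  by (simp add: hnn_extension_def cls_def mult_presented_group)

lemma cls_eqI:
  "pres_eq (hnn_gens G) (hnn_rels G A \<phi>) u v \<Longrightarrow> cls u = cls v"
  using pres_class_eq_iff pres_eq_gwords unfolding cls_def by metis

lemma hnn_gwords [simp]:
  "[] \<in> gwords (hnn_gens G)"
  "(Stable, e) # w \<in> gwords (hnn_gens G) \<longleftrightarrow> w \<in> gwords (hnn_gens G)"
  "(Base g, e) # w \<in> gwords (hnn_gens G) \<longleftrightarrow> g \<in> carrier G \<and> w \<in> gwords (hnn_gens G)"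
  by (auto simp: gwords_def hnn_gens_def)

lemma cls_closed [simp]: "w \<in> gwords (hnn_gens G) \<Longrightarrow> cls w \<in> carrier \<Gamma>"
  by (simp add: carrier_\<Gamma>)

lemma stable_closed [simp]: "stable e \<in> carrier \<Gamma>"
  and base_closed [simp]: "g \<in> carrier G \<Longrightarrow> base g \<in> carrier \<Gamma>"
  by (simp_all add: stable_def base_def)

lemma stable_False: "stable False = inv\<^bsub>\<Gamma>\<^esub> stable True"
proof (rule ext.inv_equality[symmetric])
  have "pres_eq (hnn_gens G) (hnn_rels G A \<phi>) [(Stable, False), (Stable, True)] []"
    using pres_eq.cancel[of Stable "hnn_gens G" "hnn_rels G A \<phi>" False]
    by (simp add: hnn_gens_def)
  then show "stable False \<otimes>\<^bsub>\<Gamma>\<^esub> stable True = \<one>\<^bsub>\<Gamma>\<^esub>"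
    by (simp add: stable_def mult_cls one_\<Gamma> cls_eqI)
qed simp_all

lemma base_mult:
  assumes "g \<in> carrier G" "h \<in> carrier G"
  shows "base (g \<otimes> h) = base g \<otimes>\<^bsub>\<Gamma>\<^esub> base h"
proof -
  have "pres_eq (hnn_gens G) (hnn_rels G A \<phi>)
      [(Base g, True), (Base h, True)] [(Base (g \<otimes> h), True)]"
    using assms by (intro pres_eq.rel) (auto simp: hnn_rels_def gwords_def hnn_gens_def)
  then show ?thesis
    using assms by (simp add: base_def mult_cls cls_eqI)
qed

sublocale base_hom: group_hom G \<Gamma> base
  by unfold_locales (auto simp: hom_def base_mult)

lemma cls_Base_False:
  assumes "g \<in> carrier G"
  shows "cls [(Base g, False)] = inv\<^bsub>\<Gamma>\<^esub> base g"
proof (rule ext.inv_equality[symmetric])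
  have "pres_eq (hnn_gens G) (hnn_rels G A \<phi>) [(Base g, False), (Base g, True)] []"
    using assms pres_eq.cancel[of "Base g" "hnn_gens G" "hnn_rels G A \<phi>" False]
    by (simp add: hnn_gens_def)
  then show "cls [(Base g, False)] \<otimes>\<^bsub>\<Gamma>\<^esub> base g = \<one>\<^bsub>\<Gamma>\<^esub>"
    using assms by (simp add: base_def mult_cls one_\<Gamma> cls_eqI)
qed (use assms in simp_all)

lemma subgroup_containing_generators:
  assumes H: "subgroup H \<Gamma>" and t: "stable True \<in> H" and b: "\<And>g. g \<in> carrier G \<Longrightarrow> base g \<in> H"
  shows "H = carrier \<Gamma>"
proof
  show "H \<subseteq> carrier \<Gamma>"
    using H by (rule subgroup.subset)
  have "cls w \<in> H" if "w \<in> gwords (hnn_gens G)" for w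
    using that
  proof (induction w)
    case Nil
    then show ?case
      using subgroup.one_closed[OF H] by (simp add: one_\<Gamma>)
  next
    case (Cons l w)
    obtain x e where l: "l = (x, e)" by fastforce
    have x: "x = Stable \<or> (\<exists>g\<in>carrier G. x = Base g)" and w: "w \<in> gwords (hnn_gens G)"
      using Cons.prems by (auto simp: gwords_def hnn_gens_def l)
    have "cls [l] \<in> H"
      using x t b subgroup.m_inv_closed[OF H]
      by (cases e) (auto simp: l cls_Base_False base_def[symmetric] stable_def[symmetric] stable_False)
    moreover have "cls (l # w) = cls [l] \<otimes>\<^bsub>\<Gamma>\<^esub> cls w"
      using x w l by (subst mult_cls) auto
    ultimately show ?case
      using Cons.IH[OF w] subgroup.m_closed[OF H] by simp
  qed
  then show "carrier \<Gamma> \<subseteq> H"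
    by (auto simp: carrier_\<Gamma>)
qed

lemma origin_in_nforms: "(\<one>, []) \<in> nforms"
  by (simp add: nforms_def)

lemma orbit_map_cls:
  assumes "w \<in> gwords (hnn_gens G)"
  shows "orbit_map (cls w) = word_action w (\<one>, [])"
proof -
  have "(SOME v. v \<in> cls w) \<in> cls w"
    by (rule someI[of _ w]) (simp add: cls_def pres_class_def pres_eq.refl assms)
  then show ?thesis
    using word_action_pres_eq[OF _ origin_in_nforms]
    by (auto simp: orbit_map_def cls_def pres_class_def)
qed

lemma orbit_map_in_nforms: "z \<in> carrier \<Gamma> \<Longrightarrow> orbit_map z \<in> nforms"
  by (auto simp: carrier_\<Gamma> orbit_map_cls word_action_in_nforms origin_in_nforms)

lemma orbit_map_one: "orbit_map \<one>\<^bsub>\<Gamma>\<^esub> = (\<one>, [])"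
  by (simp add: one_\<Gamma> orbit_map_cls word_action_def)

lemma orbit_map_stable: "z \<in> carrier \<Gamma> \<Longrightarrow> orbit_map (stable e \<otimes>\<^bsub>\<Gamma>\<^esub> z) = step e (orbit_map z)"
  by (auto simp: carrier_\<Gamma> stable_def mult_cls orbit_map_cls word_action_def)

lemma orbit_map_base:
  assumes "g \<in> carrier G" "z \<in> carrier \<Gamma>"
  shows "orbit_map (base g \<otimes>\<^bsub>\<Gamma>\<^esub> z) = left_mult g (orbit_map z)"
  using assms by (auto simp: carrier_\<Gamma> base_def mult_cls orbit_map_cls word_action_def)

section \<open>Pinch-free expressions\<close>

text \<open>Rigid forms are those that \<open>step e\<close> lengthens for both signs
  \<open>e\<close>.\<close>

definition rigid :: "'a nform \<Rightarrow> bool" where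
  "rigid p \<longleftrightarrow> (\<forall>e. \<not> pinches e p)"

text \<open>The shape produced by \<open>t\<^sup>e\<close> when no pinch occurs: the factor carried
  across the letter ends up in \<open>assoc_subgroup (\<not> e)\<close>.\<close>

definition fresh :: "bool \<Rightarrow> 'a nform \<Rightarrow> bool" where
  "fresh e p \<longleftrightarrow> fst p \<in> assoc_subgroup (\<not> e) \<and> snd p \<noteq> [] \<and> fst (hd (snd p)) = e"

lemma fresh_step:
  assumes "p \<in> nforms" "\<not> pinches e p"
  shows "fresh e (step e p)"
  using assms(1)
proof (cases rule: nform_cases[where e = e])
  case (pinch d r w)
  then show ?thesis
    using assms(2) by (simp add: pinches_def)
next
  case (no_pinch d r w)
  then show ?thesis
    by (simp add: step_no_pinch pinches_left_mult fresh_def transport_in)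
qed

text \<open>The leading sign alone excludes the pinch, so any \<open>g\<close> may stand between two
  equal stable letters. This is why generators are wrapped as \<open>s t g t s\<close>.\<close>

lemma fresh_not_pinches: "fresh e p \<Longrightarrow> \<not> pinches e (left_mult g p)"
  by (simp add: fresh_def pinches_def left_mult_def)

text \<open>Only the sign opposite to \<open>e\<close> could pinch, and then \<open>s\<close> would
  lie in \<open>assoc_subgroup (\<not> e)\<close> because \<open>fst p\<close> does.\<close>

lemma rigid_left_mult:
  assumes "fresh e p" "s \<in> carrier G" "s \<notin> A" "s \<notin> B"
  shows "rigid (left_mult s p)"
proof -
  have "s \<otimes> fst p \<notin> assoc_subgroup (\<not> e)"
  proof
    assume *: "s \<otimes> fst p \<in> assoc_subgroup (\<not> e)"
    have p: "fst p \<in> assoc_subgroup (\<not> e)"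
      using assms(1) by (simp add: fresh_def)
    then have "s \<otimes> fst p \<otimes> inv (fst p) \<in> assoc_subgroup (\<not> e)"
      using * by (blast intro: assoc_mult assoc_inv)
    then show False
      using assms assoc_carrier[OF p] by (simp add: m_assoc assoc_subgroup_def split: if_splits)
  qed
  then have "\<not> pinches e' (left_mult s p)" for e'
    using assms(1) by (cases "e' = e") (auto simp: pinches_def fresh_def left_mult_def)
  then show ?thesis
    by (simp add: rigid_def)
qed

section \<open>Powers of the stable letter on rigid forms\<close>

definition sgn_of :: "bool \<Rightarrow> int" where
  "sgn_of e = (if e then 1 else - 1)"

abbreviation t_pow :: "int \<Rightarrow> 'a hnn_gen gword set" where
  "t_pow k \<equiv> stable True [^]\<^bsub>\<Gamma>\<^esub> k"

lemma t_pow_sgn_of: "t_pow (sgn_of e) = stable e"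
  by (simp add: sgn_of_def stable_False ext.int_pow_neg)

lemma t_pow_add: "t_pow (i + j) = t_pow i \<otimes>\<^bsub>\<Gamma>\<^esub> t_pow j"
  by (simp add: ext.int_pow_mult)

lemma t_pow_add_mult:
  "z \<in> carrier \<Gamma> \<Longrightarrow> t_pow i \<otimes>\<^bsub>\<Gamma>\<^esub> (t_pow j \<otimes>\<^bsub>\<Gamma>\<^esub> z) = t_pow (i + j) \<otimes>\<^bsub>\<Gamma>\<^esub> z"
  by (simp add: t_pow_add ext.m_assoc)

text \<open>Rigidity protects the first letter; each later one has the same sign as its predecessor,
  so \<open>fresh_not_pinches\<close> applies.\<close>

lemma fresh_t_pow_Suc:
  assumes "z \<in> carrier \<Gamma>" "rigid (orbit_map z)"
  shows "fresh e (orbit_map (t_pow (sgn_of e * int (Suc n)) \<otimes>\<^bsub>\<Gamma>\<^esub> z))"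
proof (induction n)
  case 0
  then show ?case
    using assms by (simp add: t_pow_sgn_of orbit_map_stable fresh_step orbit_map_in_nforms rigid_def)
next
  case (Suc n)
  let ?y = "t_pow (sgn_of e * int (Suc n)) \<otimes>\<^bsub>\<Gamma>\<^esub> z"
  have y: "?y \<in> carrier \<Gamma>"
    using assms by simp
  have "sgn_of e * int (Suc (Suc n)) = sgn_of e + sgn_of e * int (Suc n)"
    by (simp add: algebra_simps)
  then have "t_pow (sgn_of e * int (Suc (Suc n))) \<otimes>\<^bsub>\<Gamma>\<^esub> z = stable e \<otimes>\<^bsub>\<Gamma>\<^esub> ?y"
    using assms by (simp only: t_pow_add_mult[symmetric] t_pow_sgn_of)
  then show ?case
    using Suc y fresh_not_pinches[OF Suc, of \<one>]
    by (simp add: orbit_map_stable fresh_step orbit_map_in_nforms left_mult_one)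
qed

lemma fresh_t_pow:
  assumes "z \<in> carrier \<Gamma>" "rigid (orbit_map z)" "k \<noteq> 0"
  shows "\<exists>e. fresh e (orbit_map (t_pow k \<otimes>\<^bsub>\<Gamma>\<^esub> z))"
proof -
  have "k = sgn_of (k > 0) * int (Suc (nat \<bar>k\<bar> - 1))"
    using assms(3) by (auto simp: sgn_of_def)
  then show ?thesis
    using fresh_t_pow_Suc[OF assms(1,2)] by metis
qed

section \<open>Generating sets without short relations\<close>

context
  fixes s :: 'a and q :: "nat \<Rightarrow> 'a" and N :: nat
  assumes s: "s \<in> carrier G" "s \<notin> A" "s \<notin> B" and q: "\<And>i. q i \<in> carrier G"
begin

definition core :: "nat \<Rightarrow> 'a hnn_gen gword set" where
  "core i = (case i of 0 \<Rightarrow> base s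
     | Suc j \<Rightarrow> base s \<otimes>\<^bsub>\<Gamma>\<^esub> (stable True \<otimes>\<^bsub>\<Gamma>\<^esub> (base (q j) \<otimes>\<^bsub>\<Gamma>\<^esub> (stable True \<otimes>\<^bsub>\<Gamma>\<^esub> base s))))"

text \<open>Positive multiples of \<open>N + 1\<close>: each one, and the distance between any two
  different ones, exceeds \<open>N\<close>.\<close>

definition expo :: "nat \<Rightarrow> int" where
  "expo i = int (Suc i) * int (Suc N)"

text \<open>Equal exponents on both sides of the core give the inverse the same shape with the sign
  reversed, as in \<open>signed_gen_Suc\<close>.\<close>

definition gen :: "nat \<Rightarrow> 'a hnn_gen gword set" where
  "gen i = (case i of 0 \<Rightarrow> stable True
     | Suc j \<Rightarrow> t_pow (expo j) \<otimes>\<^bsub>\<Gamma>\<^esub> (core j \<otimes>\<^bsub>\<Gamma>\<^esub> t_pow (expo j)))"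

definition signed :: "'a hnn_gen gword set \<Rightarrow> bool \<Rightarrow> 'a hnn_gen gword set" where
  "signed x e = (if e then x else inv\<^bsub>\<Gamma>\<^esub> x)"

lemma core_closed [simp]: "core i \<in> carrier \<Gamma>"
  using s q by (auto simp: core_def split: nat.split)

lemma gen_closed [simp]: "gen i \<in> carrier \<Gamma>"
  by (auto simp: gen_def split: nat.split)

lemma signed_closed [simp]: "x \<in> carrier \<Gamma> \<Longrightarrow> signed x e \<in> carrier \<Gamma>"
  by (simp add: signed_def)

lemma signed_gen_0: "signed (gen 0) e = stable e"
  by (simp add: signed_def gen_def stable_False)

lemma signed_gen_Suc:
  "signed (gen (Suc i)) e =
    t_pow (sgn_of e * expo i) \<otimes>\<^bsub>\<Gamma>\<^esub> (signed (core i) e \<otimes>\<^bsub>\<Gamma>\<^esub> t_pow (sgn_of e * expo i))"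
  by (simp add: signed_def gen_def sgn_of_def ext.inv_mult_group ext.int_pow_neg ext.m_assoc)

lemma signed_core_Suc:
  "signed (core (Suc j)) e = base (if e then s else inv s) \<otimes>\<^bsub>\<Gamma>\<^esub> (stable e \<otimes>\<^bsub>\<Gamma>\<^esub>
    (base (if e then q j else inv (q j)) \<otimes>\<^bsub>\<Gamma>\<^esub> (stable e \<otimes>\<^bsub>\<Gamma>\<^esub> base (if e then s else inv s))))"
  using s q by (simp add: signed_def core_def ext.inv_mult_group ext.m_assoc stable_False)

text \<open>Read from right to left: \<open>s\<close> or its inverse makes the form rigid,
  \<open>t\<close> then makes it fresh, a second \<open>t\<close> of equal sign passes over the
  generator, and the last \<open>s\<close> restores rigidity.\<close>

lemma rigid_core:
  assumes z: "z \<in> carrier \<Gamma>" and f: "fresh e (orbit_map z)"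
  shows "rigid (orbit_map (signed (core i) \<delta> \<otimes>\<^bsub>\<Gamma>\<^esub> z)) \<and>
    snd (orbit_map (signed (core i) \<delta> \<otimes>\<^bsub>\<Gamma>\<^esub> z)) \<noteq> []"
proof -
  define s' where "s' = (if \<delta> then s else inv s)"
  have s': "s' \<in> carrier G" "s' \<notin> A" "s' \<notin> B"
    using s subgroup.m_inv_closed[OF subgroup_A, of "inv s"]
      subgroup.m_inv_closed[OF subgroup_B, of "inv s"] by (auto simp: s'_def)
  have step_s: "rigid (orbit_map (base s' \<otimes>\<^bsub>\<Gamma>\<^esub> y)) \<and> snd (orbit_map (base s' \<otimes>\<^bsub>\<Gamma>\<^esub> y)) \<noteq> []"
    if "y \<in> carrier \<Gamma>" "fresh e (orbit_map y)" for y e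
    using that s' rigid_left_mult[OF that(2) s']
    by (simp add: orbit_map_base) (simp add: left_mult_def fresh_def)
  show ?thesis
  proof (cases i)
    case 0
    then have "signed (core i) \<delta> = base s'"
      using s by (simp add: core_def signed_def s'_def)
    then show ?thesis
      using step_s[OF z f] by simp
  next
    case (Suc j)
    define g where "g = (if \<delta> then q j else inv (q j))"
    have g: "g \<in> carrier G"
      using q by (simp add: g_def)
    define y1 where "y1 = base s' \<otimes>\<^bsub>\<Gamma>\<^esub> z"
    define y2 where "y2 = stable \<delta> \<otimes>\<^bsub>\<Gamma>\<^esub> y1"
    define y3 where "y3 = stable \<delta> \<otimes>\<^bsub>\<Gamma>\<^esub> (base g \<otimes>\<^bsub>\<Gamma>\<^esub> y2)"
    have y: "y1 \<in> carrier \<Gamma>" "y2 \<in> carrier \<Gamma>" "y3 \<in> carrier \<Gamma>"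
      using z s' g by (simp_all add: y1_def y2_def y3_def)
    have "fresh \<delta> (orbit_map y2)"
      using step_s[OF z f] y
      by (simp add: y2_def orbit_map_stable y1_def[symmetric] fresh_step orbit_map_in_nforms rigid_def)
    then have "fresh \<delta> (orbit_map y3)"
      using y g by (simp add: y3_def orbit_map_stable orbit_map_base fresh_step fresh_not_pinches
          left_mult_in_nforms orbit_map_in_nforms)
    moreover have "signed (core i) \<delta> \<otimes>\<^bsub>\<Gamma>\<^esub> z = base s' \<otimes>\<^bsub>\<Gamma>\<^esub> y3"
      using s' g z unfolding Suc signed_core_Suc s'_def[symmetric] g_def[symmetric]
      by (simp add: y1_def y2_def y3_def ext.m_assoc)
    ultimately show ?thesis
      using step_s[OF y(3)] by simp
  qed
qed

section \<open>Reduced words over the indices of the generators\<close>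

definition index_value :: "(nat \<times> bool) list \<Rightarrow> 'a hnn_gen gword set" where
  "index_value v = foldr (\<lambda>(i, e) y. signed (gen i) e \<otimes>\<^bsub>\<Gamma>\<^esub> y) v \<one>\<^bsub>\<Gamma>\<^esub>"

lemma index_value_closed [simp]: "index_value v \<in> carrier \<Gamma>"
  by (induction v) (auto simp: index_value_def)

lemma index_value_Cons: "index_value ((i, e) # v) = signed (gen i) e \<otimes>\<^bsub>\<Gamma>\<^esub> index_value v"
  by (simp add: index_value_def)

lemma expo_gt: "expo i > int N"
proof -
  have "int N < 1 * int (Suc N)"
    by simp
  also have "\<dots> \<le> expo i"
    unfolding expo_def by (intro mult_right_mono) auto
  finally show ?thesis .
qed

lemma expo_diff:
  assumes "i \<noteq> j"
  shows "\<bar>expo i - expo j\<bar> > int N"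
proof -
  have "int N < 1 * int (Suc N)"
    by simp
  also have "\<dots> \<le> \<bar>int i - int j\<bar> * int (Suc N)"
    using assms by (intro mult_right_mono) auto
  also have "\<dots> = \<bar>(int i - int j) * int (Suc N)\<bar>"
    by (simp add: abs_mult)
  also have "(int i - int j) * int (Suc N) = expo i - expo j"
    by (simp add: expo_def algebra_simps)
  finally show ?thesis .
qed

text \<open>This is the exponent of \<open>t\<close> between neighbouring cores. For equal signs or
  different indices the outer exponents add up to more than \<open>N\<close> in absolute value,
  which \<open>k\<close> cannot cancel; otherwise \<open>k\<close> alone remains.\<close>

lemma phase_nonzero:
  assumes "\<bar>k\<bar> \<le> int N" "i = j \<Longrightarrow> \<delta> \<noteq> e \<Longrightarrow> k \<noteq> 0"
  shows "sgn_of \<delta> * expo i + (sgn_of e * expo j + k) \<noteq> 0"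
  using assms expo_diff[of i j] expo_gt[of i] expo_gt[of j]
  by (cases "i = j"; cases \<delta>; cases e) (auto simp: sgn_of_def)

lemma sgn_expo_inject: "sgn_of \<delta> * expo i = sgn_of e * expo j \<Longrightarrow> \<delta> = e \<and> i = j"
  using expo_diff[of i j] expo_gt[of i] expo_gt[of j]
  by (cases "i = j"; cases \<delta>; cases e) (auto simp: sgn_of_def)

text \<open>The value of a word \<open>v\<close> is written \<open>t\<^bsup>p + k\<^esup> z\<close>, where \<open>z\<close> begins with the leftmost core, \<open>p\<close> is
  the exponent contributed by the generator of that core and \<open>k\<close> the one contributed by the letters
  \<open>t\<^sup>\<plusminus>\<^sup>1\<close> to its left.\<close>

fun head_phase :: "(nat \<times> bool) list \<Rightarrow> int \<Rightarrow> int \<Rightarrow> bool" where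
  "head_phase [] p k \<longleftrightarrow> p = 0 \<and> k = 0"
| "head_phase ((0, e) # v) p k \<longleftrightarrow> sgn_of e * k > 0"
| "head_phase ((Suc j, e) # v) p k \<longleftrightarrow> p = sgn_of e * expo j \<and> k = 0"

text \<open>The induction prepends a letter. \<open>head_phase\<close> keeps enough of the old first
  letter to exploit free reducedness, and \<open>p = 0\<close> marks that no core has occurred
  yet.\<close>

lemma reduced_value:
  assumes "freely_reduced v" "length v \<le> N"
  shows "\<exists>k p z. index_value v = t_pow (p + k) \<otimes>\<^bsub>\<Gamma>\<^esub> z \<and> z \<in> carrier \<Gamma> \<and> rigid (orbit_map z) \<and>
    \<bar>k\<bar> \<le> int (length v) \<and>
    (p = 0 \<or> (\<exists>i e. p = sgn_of e * expo i) \<and> snd (orbit_map z) \<noteq> []) \<and>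
    head_phase v p k"
  using assms
proof (induction v)
  case Nil
  have "index_value [] = t_pow (0 + 0) \<otimes>\<^bsub>\<Gamma>\<^esub> \<one>\<^bsub>\<Gamma>\<^esub>" "rigid (orbit_map \<one>\<^bsub>\<Gamma>\<^esub>)"
    by (simp_all add: index_value_def orbit_map_one rigid_def pinches_def)
  then show ?case
    by force
next
  case (Cons l v)
  obtain i e where l: "l = (i, e)" by fastforce
  have red: "freely_reduced v" and hd_red: "v \<noteq> [] \<Longrightarrow> hd v \<noteq> (i, \<not> e)"
    using Cons.prems(1) by (auto simp: freely_reduced_def l successively_Cons)
  obtain k p z where v: "index_value v = t_pow (p + k) \<otimes>\<^bsub>\<Gamma>\<^esub> z" "z \<in> carrier \<Gamma>"
      "rigid (orbit_map z)" "\<bar>k\<bar> \<le> int (length v)"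
      "p = 0 \<or> (\<exists>i e. p = sgn_of e * expo i) \<and> snd (orbit_map z) \<noteq> []"
    and hd_v: "head_phase v p k"
    using Cons.IH[OF red Suc_leD] Cons.prems(2) unfolding length_Cons by blast
  show ?case
  proof (cases i)
    case 0
    have "index_value (l # v) = t_pow (sgn_of e) \<otimes>\<^bsub>\<Gamma>\<^esub> (t_pow (p + k) \<otimes>\<^bsub>\<Gamma>\<^esub> z)"
      by (simp add: l 0 index_value_Cons v(1) signed_gen_0 t_pow_sgn_of)
    also have "\<dots> = t_pow (p + (k + sgn_of e)) \<otimes>\<^bsub>\<Gamma>\<^esub> z"
      using v(2) by (simp only: t_pow_add_mult ac_simps)
    finally have "index_value (l # v) = t_pow (p + (k + sgn_of e)) \<otimes>\<^bsub>\<Gamma>\<^esub> z" .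
    \<comment> \<open>Before this letter \<open>k\<close> is zero or, by reducedness, already has
      the sign of \<open>e\<close>.\<close>
    moreover have "sgn_of e * (k + sgn_of e) > 0"
      using hd_v hd_red 0
      by (cases "(v, p, k)" rule: head_phase.cases) (auto simp: sgn_of_def split: if_splits)
    moreover have "\<bar>k + sgn_of e\<bar> \<le> int (length (l # v))"
      using v(4) by (auto simp: sgn_of_def)
    ultimately show ?thesis
      using v(2,3,5) l 0 by (intro exI[of _ "k + sgn_of e"] exI[of _ p] exI[of _ z]) simp
  next
    case (Suc j)
    let ?x = "sgn_of e * expo j"
    let ?y = "t_pow (?x + (p + k)) \<otimes>\<^bsub>\<Gamma>\<^esub> z"
    \<comment> \<open>This power of \<open>t\<close> stands directly to the right of the new core;
      once it is non-zero, \<open>fresh_t_pow\<close> and \<open>rigid_core\<close> apply.\<close>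
    have "?x + (p + k) \<noteq> 0"
    proof (cases "p = 0")
      case True
      then show ?thesis
        using v(4) Cons.prems(2) expo_gt[of j] by (auto simp: sgn_of_def)
    next
      case False
      then obtain i' e' where p: "p = sgn_of e' * expo i'"
        using v(5) by blast
      \<comment> \<open>If \<open>k = 0\<close>, then \<open>v\<close> starts with the generator
        that contributed \<open>p\<close>, here the formal inverse of the new letter.\<close>
      have "k \<noteq> 0" if "j = i'" "e \<noteq> e'"
        using hd_v hd_red Suc False that p
        by (cases "(v, p, k)" rule: head_phase.cases) (auto dest: sgn_expo_inject)
      then show ?thesis
        unfolding p using phase_nonzero v(4) Cons.prems(2) by simp
    qed
    then obtain e' where "fresh e' (orbit_map ?y)"
      using fresh_t_pow v(2,3) by blast
    then have "rigid (orbit_map (signed (core j) e \<otimes>\<^bsub>\<Gamma>\<^esub> ?y))"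
        "snd (orbit_map (signed (core j) e \<otimes>\<^bsub>\<Gamma>\<^esub> ?y)) \<noteq> []"
      using rigid_core v(2) by simp_all
    moreover have "index_value (l # v) = t_pow (?x + 0) \<otimes>\<^bsub>\<Gamma>\<^esub> (signed (core j) e \<otimes>\<^bsub>\<Gamma>\<^esub> ?y)"
      using v(2)
      by (simp add: l Suc index_value_Cons v(1) signed_gen_Suc ext.m_assoc
          t_pow_add_mult[symmetric])
    ultimately show ?thesis
      using v(2) l Suc
      by (intro exI[of _ 0] exI[of _ ?x] exI[of _ "signed (core j) e \<otimes>\<^bsub>\<Gamma>\<^esub> ?y"]) auto
  qed
qed

lemma index_value_neq_one:
  assumes "freely_reduced v" "length v \<le> N" "v \<noteq> []"
  shows "index_value v \<noteq> \<one>\<^bsub>\<Gamma>\<^esub>"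
proof -
  obtain k p z where v: "index_value v = t_pow (p + k) \<otimes>\<^bsub>\<Gamma>\<^esub> z" "z \<in> carrier \<Gamma>"
      "rigid (orbit_map z)" "p = 0 \<or> snd (orbit_map z) \<noteq> []"
    and hd_v: "head_phase v p k"
    using reduced_value[OF assms(1,2)] by blast
  have "snd (orbit_map (index_value v)) \<noteq> []"
  proof (cases "p + k = 0")
    case True
    \<comment> \<open>Only the empty word has \<open>p = k = 0\<close>; so a core occurs, and
      \<open>z\<close> has a non-empty normal form.\<close>
    have "p \<noteq> 0"
    proof
      assume "p = 0"
      with True have "p = 0" "k = 0"
        by simp_all
      moreover have "sgn_of e * expo j \<noteq> 0" for e j
        using expo_gt[of j] by (simp add: sgn_of_def)
      ultimately show False
        using hd_v assms(3) by (cases "(v, p, k)" rule: head_phase.cases) auto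
    qed
    then show ?thesis
      using v True by simp
  next
    case False
    then show ?thesis
      using fresh_t_pow[OF v(2,3)] by (auto simp: v(1) fresh_def)
  qed
  then show ?thesis
    by (auto simp: orbit_map_one)
qed

section \<open>Generation of the extension and the bound on the girth\<close>

lemma generate_gen:
  assumes q_gen: "generate G (q ` {..<n}) = carrier G"
  shows "generate \<Gamma> (gen ` {..Suc n}) = carrier \<Gamma>"
proof (rule subgroup_containing_generators)
  let ?H = "generate \<Gamma> (gen ` {..Suc n})"
  show H: "subgroup ?H \<Gamma>"
    by (rule ext.generate_is_subgroup) auto
  have gen: "gen i \<in> ?H" if "i \<le> Suc n" for i
    using that by (blast intro: generate.incl)
  from gen[of 0] show t: "stable True \<in> ?H"
    by (simp add: gen_def)
  have t_pow: "t_pow k \<in> ?H" for k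
    using ext.subgroup_int_pow_closed[OF H t] .
  \<comment> \<open>Dividing off known outer factors yields first the cores, then each
    \<open>base (q j)\<close>.\<close>
  have cancel: "y \<in> ?H" if "a \<otimes>\<^bsub>\<Gamma>\<^esub> (y \<otimes>\<^bsub>\<Gamma>\<^esub> b) \<in> ?H" "a \<in> ?H" "b \<in> ?H" "y \<in> carrier \<Gamma>" for a b y
  proof -
    have ab: "a \<in> carrier \<Gamma>" "b \<in> carrier \<Gamma>"
      using that subgroup.mem_carrier[OF H] by blast+
    have "inv\<^bsub>\<Gamma>\<^esub> a \<otimes>\<^bsub>\<Gamma>\<^esub> (a \<otimes>\<^bsub>\<Gamma>\<^esub> (y \<otimes>\<^bsub>\<Gamma>\<^esub> b)) \<otimes>\<^bsub>\<Gamma>\<^esub> inv\<^bsub>\<Gamma>\<^esub> b \<in> ?H"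
      using that(1-3) by (blast intro: subgroup.m_closed[OF H] subgroup.m_inv_closed[OF H])
    moreover have "inv\<^bsub>\<Gamma>\<^esub> a \<otimes>\<^bsub>\<Gamma>\<^esub> (a \<otimes>\<^bsub>\<Gamma>\<^esub> (y \<otimes>\<^bsub>\<Gamma>\<^esub> b)) = y \<otimes>\<^bsub>\<Gamma>\<^esub> b"
      using ab that(4) by (simp add: ext.m_assoc[symmetric])
    moreover have "y \<otimes>\<^bsub>\<Gamma>\<^esub> b \<otimes>\<^bsub>\<Gamma>\<^esub> inv\<^bsub>\<Gamma>\<^esub> b = y"
      using ab that(4) by (simp add: ext.m_assoc)
    ultimately show ?thesis
      by simp
  qed
  have core: "core i \<in> ?H" if "i \<le> n" for i
    using cancel[OF _ t_pow t_pow core_closed] gen[of "Suc i"] that by (simp add: gen_def)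
  from core[of 0] have base_s: "base s \<in> ?H"
    by (simp add: core_def)
  have base_q: "base (q j) \<in> ?H" if "j < n" for j
  proof -
    have "(base s \<otimes>\<^bsub>\<Gamma>\<^esub> stable True) \<otimes>\<^bsub>\<Gamma>\<^esub> (base (q j) \<otimes>\<^bsub>\<Gamma>\<^esub> (stable True \<otimes>\<^bsub>\<Gamma>\<^esub> base s)) \<in> ?H"
      using core[of "Suc j"] that s q by (simp add: core_def ext.m_assoc)
    then show ?thesis
      by (rule cancel) (simp_all add: subgroup.m_closed[OF H] base_s t q)
  qed
  show "base g \<in> ?H" if "g \<in> carrier G" for g
  proof -
    have "base ` generate G (q ` {..<n}) = generate \<Gamma> (base ` q ` {..<n})"
      using q by (intro base_hom.generate_img[symmetric]) auto
    also have "\<dots> \<subseteq> ?H"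
      using base_q by (intro ext.generate_subgroup_incl H) auto
    finally show ?thesis
      using that q_gen by auto
  qed
qed

text \<open>A shorter relation would translate into a freely reduced word over indices,
  contradicting \<open>index_value_neq_one\<close>.\<close>

lemma girth_wrt_gen: "girth_wrt \<Gamma> (gen ` I) \<ge> enat N"
  unfolding girth_wrt_def
proof (rule INF_greatest, rule ccontr)
  fix w
  assume w: "w \<in> {w \<in> gwords (gen ` I). w \<noteq> [] \<and> freely_reduced w \<and> word_value \<Gamma> w = \<one>\<^bsub>\<Gamma>\<^esub>}"
    and len: "\<not> enat N \<le> enat (length w)"
  \<comment> \<open>One index is chosen per generator, so distinct letters get distinct indices and
    free reducedness survives.\<close>
  define idx where "idx = inv_into I gen"
  define v where "v = map (\<lambda>(x, e). (idx x, e)) w"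
  have gen_idx: "gen (idx x) = x" if "(x, e) \<in> set w" for x e
    using that w by (auto simp: gwords_def idx_def f_inv_into_f)
  have "freely_reduced v"
    unfolding v_def freely_reduced_def successively_map
  proof (rule successively_mono)
    show "successively (\<lambda>p q. \<not> (fst p = fst q \<and> snd p \<noteq> snd q)) w"
      using w by (simp add: freely_reduced_def)
  next
    fix l m
    assume lm: "l \<in> set w" "m \<in> set w" "\<not> (fst l = fst m \<and> snd l \<noteq> snd m)"
    have "gen (idx (fst l)) = fst l" "gen (idx (fst m)) = fst m"
      using lm(1,2) gen_idx[of "fst l" "snd l"] gen_idx[of "fst m" "snd m"] by simp_all
    then have "idx (fst l) = idx (fst m) \<Longrightarrow> fst l = fst m"
      by metis
    with lm(3) show "\<not> (fst (case l of (x, e) \<Rightarrow> (idx x, e)) = fst (case m of (x, e) \<Rightarrow> (idx x, e)) \<and>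
        snd (case l of (x, e) \<Rightarrow> (idx x, e)) \<noteq> snd (case m of (x, e) \<Rightarrow> (idx x, e)))"
      unfolding split_beta fst_conv snd_conv by blast
  qed
  moreover have "word_value \<Gamma> u = index_value (map (\<lambda>(x, e). (idx x, e)) u)"
    if "set u \<subseteq> set w" for u
    using that
  proof (induction u)
    case Nil
    then show ?case
      by (simp add: word_value_def index_value_def)
  next
    case (Cons l u)
    obtain x e where l: "l = (x, e)" by fastforce
    have "gen (idx x) = x"
      using Cons.prems gen_idx[of x e] by (simp add: l)
    with Cons show ?case
      by (simp add: l word_value_def index_value_def signed_def)
  qed
  from this[of w] have "word_value \<Gamma> w = index_value v"
    by (simp add: v_def)
  ultimately show False
    using index_value_neq_one[of v] w len by (auto simp: v_def)
qed

end

end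

theorem theorem1p1:
  fixes G :: "('a, 'b) monoid_scheme" and A B :: "'a set" and \<phi> :: "'a \<Rightarrow> 'a"
  assumes "group G" and "finitely_generated G"
    and "subgroup A G" and "A \<noteq> carrier G"
    and "subgroup B G" and "B \<noteq> carrier G"
    and "\<phi> \<in> iso (G\<lparr>carrier := A\<rparr>) (G\<lparr>carrier := B\<rparr>)"
  shows "girth (hnn_extension G A \<phi>) = \<infinity>"
proof -
  interpret hnn_datum G A B \<phi>
    by (intro hnn_datum.intro hnn_datum_axioms.intro assms)
  obtain s where s: "s \<in> carrier G" "s \<notin> A" "s \<notin> B"
    using exists_outside_two_subgroups[OF assms(3-6)] by blast
  obtain S where S: "finite S" "S \<subseteq> carrier G" "generate G S = carrier G"
    using assms(2) by (auto simp: finitely_generated_def finite_generating_set_def)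
  obtain n and f :: "nat \<Rightarrow> 'a" where f: "S = f ` {..<n}"
    using finite_imp_nat_seg_image_inj_on[OF S(1)] by (metis lessThan_def)
  \<comment> \<open>The default keeps \<open>q i\<close> in the carrier for every index, as the
    assumption on \<open>q\<close> demands.\<close>
  define q where "q i = (if i < n then f i else \<one>\<^bsub>G\<^esub>)" for i
  have q: "q i \<in> carrier G" for i
    using S(2) f by (auto simp: q_def)
  have "q ` {..<n} = S"
    by (auto simp: q_def f)
  with S(3) have q_gen: "generate G (q ` {..<n}) = carrier G"
    by simp
  have ge: "enat N \<le> girth (hnn_extension G A \<phi>)" for N
  proof -
    \<comment> \<open>Index 0 is \<open>t\<close>, index 1 belongs to \<open>s\<close>, and the
      indices from 2 to \<open>Suc n\<close> belong to the \<open>n\<close> generators of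
      \<open>G\<close>.\<close>
    have "finite_generating_set (hnn_extension G A \<phi>) (gen s q N ` {..Suc n})"
      unfolding finite_generating_set_def
      by (intro conjI generate_gen[OF s q q_gen] image_subsetI gen_closed[OF s q]) simp
    then have "girth_wrt (hnn_extension G A \<phi>) (gen s q N ` {..Suc n}) \<le> girth (hnn_extension G A \<phi>)"
      unfolding girth_def by (intro SUP_upper CollectI)
    then show ?thesis
      using girth_wrt_gen[OF s q] by (rule order_trans[rotated])
  qed
  show ?thesis
  proof (rule ccontr)
    assume "girth (hnn_extension G A \<phi>) \<noteq> \<infinity>"
    then obtain m where "girth (hnn_extension G A \<phi>) = enat m"
      by blast
    with ge[of "Suc m"] show False
      by simp
  qed
qed

end
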